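(* There is a Boolean query definable by a first-order sentence of the form $\exists\vec x\,\forall\vec y\,\psi$ with $\psi$ quantifier-free which cannot be maintained by a $\mathrm{DynProp}$-program (of any arity).
   Context: Dynamic complexity framework. A dynamic schema is a pair $(\tau_{\mathrm{in}},\tau_{\mathrm{aux}})$ of an input schema and an auxiliary schema ($\tau_{\mathrm{aux}}$ consists of relation symbols only); put $\tau=\tau_{\mathrm{in}}\cup\tau_{\mathrm{aux}}$. A modification of a database over a finite domain $D$ is an insertion $\mathrm{ins}_S(\vec a)$ or a deletion $\mathrm{del}_S(\vec a)$ of a tuple $\vec a$ over $D$ into/from a relation $S\in\tau_{\mathrm{in}}$. An update program $P$ contains, for each $R\in\tau_{\mathrm{aux}}$ and each $\delta\in\{\mathrm{ins}_S,\mathrm{del}_S\}$, $S\in\tau_{\mathrm{in}}$, a formula $\varphi^R_\delta(\vec x;\vec y)$ over $\tau$ with $|\vec x|$ the arity of $S$ and $|\vec y|$ the arity of $R$. A program state is $(D,\mathcal I,\mathcal A)$ with input database $\mathcal I$ and auxiliary database $\mathcal A$ over $D$. Applying $\delta(\vec a)$ to a state $\mathcal S$ modifies the input database by $\delta(\vec a)$ and reinterprets each $R\in\tau_{\mathrm{aux}}$ as $\{\vec b:\mathcal S\models\varphi^R_\delta(\vec a;\vec b)\}$ (evaluated in the old state); sequences are applied one after another. A dynamic program $(P,\mathrm{Init},Q)$ has an arbitrary initialization mapping $\mathrm{Init}$ from input databases to auxiliary databases over the same domain and a designated query symbol $Q\in\tau_{\mathrm{aux}}$; it maintains a query $\mathcal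 Q$ if for every input database $\mathcal D$ over any finite domain and every sequence $\alpha$ of modifications, the value of $Q$ in the state reached from $(D,\mathcal D,\mathrm{Init}(\mathcal D))$ by applying $\alpha$ equals $\mathcal Q(\alpha(\mathcal D))$. A $\mathrm{DynProp}$-program is one whose update formulas are quantifier-free. *)

theory Defs
  imports "HOL-Library.FuncSet"
begin

section \<open>Schemas and databases\<close>

record ('r, 'c) schema =
  rsyms :: "'r set"
  arity :: "'r \<Rightarrow> nat"
  csyms :: "'c set"

definition finite_schema :: "('r, 'c) schema \<Rightarrow> bool" where
  "finite_schema \<tau> \<longleftrightarrow> finite (rsyms \<tau>) \<and> finite (csyms \<tau>)"

definition tuples :: "'d set \<Rightarrow> nat \<Rightarrow> 'd list set" where
  "tuples D k = {as. set as \<subseteq> D \<and> length as = k}"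

text \<open>Interpretations are extensional functions on the symbols of the schema (they are
  \<open>undefined\<close> on other symbols), so that a database is determined by its domain and by the
  values of its symbols.\<close>

definition rel_interps :: "('r, 'c) schema \<Rightarrow> 'd set \<Rightarrow> ('r \<Rightarrow> 'd list set) set" where
  "rel_interps \<tau> D = (\<Pi>\<^sub>E R\<in>rsyms \<tau>. Pow (tuples D (arity \<tau> R)))"

record ('d, 'r, 'c) db =
  domain :: "'d set"
  rel    :: "'r \<Rightarrow> 'd list set"
  const  :: "'c \<Rightarrow> 'd"

text \<open>Domains are nonempty, as usual in finite model theory. Since every finite database has an
  isomorphic copy with a domain of natural numbers and initializations are arbitrary maps,
  instantiating \<open>'d\<close> with \<open>nat\<close> covers all finite domains.\<close>

definition databases :: "('r, 'c) schema \<Rightarrow> ('d, 'r, 'c) db set" where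
  "databases \<tau> = {I. finite (domain I) \<and> domain I \<noteq> {} \<and>
     rel I \<in> rel_interps \<tau> (domain I) \<and> const I \<in> csyms \<tau> \<rightarrow>\<^sub>E domain I}"


section \<open>First-order logic\<close>

datatype 'c tm = Var nat | Const 'c

datatype ('r, 'c) fm =
    Bot
  | Eq "'c tm" "'c tm"
  | Atom 'r "'c tm list"
  | Neg "('r, 'c) fm"
  | Conj "('r, 'c) fm" "('r, 'c) fm"
  | Disj "('r, 'c) fm" "('r, 'c) fm"
  | Ex nat "('r, 'c) fm"
  | All nat "('r, 'c) fm"

fun eval_tm :: "('d, 'r, 'c) db \<Rightarrow> (nat \<Rightarrow> 'd) \<Rightarrow> 'c tm \<Rightarrow> 'd" where
  "eval_tm I \<sigma> (Var v) = \<sigma> v"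
| "eval_tm I \<sigma> (Const c) = const I c"

fun sat :: "('d, 'r, 'c) db \<Rightarrow> (nat \<Rightarrow> 'd) \<Rightarrow> ('r, 'c) fm \<Rightarrow> bool" where
  "sat I \<sigma> Bot \<longleftrightarrow> False"
| "sat I \<sigma> (Eq s t) \<longleftrightarrow> eval_tm I \<sigma> s = eval_tm I \<sigma> t"
| "sat I \<sigma> (Atom R ts) \<longleftrightarrow> map (eval_tm I \<sigma>) ts \<in> rel I R"
| "sat I \<sigma> (Neg \<phi>) \<longleftrightarrow> \<not> sat I \<sigma> \<phi>"
| "sat I \<sigma> (Conj \<phi> \<psi>) \<longleftrightarrow> sat I \<sigma> \<phi> \<and> sat I \<sigma> \<psi>"
| "sat I \<sigma> (Disj \<phi> \<psi>) \<longleftrightarrow> sat I \<sigma> \<phi> \<or> sat I \<sigma> \<psi>"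
| "sat I \<sigma> (Ex v \<phi>) \<longleftrightarrow> (\<exists>d\<in>domain I. sat I (\<sigma>(v := d)) \<phi>)"
| "sat I \<sigma> (All v \<phi>) \<longleftrightarrow> (\<forall>d\<in>domain I. sat I (\<sigma>(v := d)) \<phi>)"

fun fv_tm :: "'c tm \<Rightarrow> nat set" where
  "fv_tm (Var v) = {v}"
| "fv_tm (Const c) = {}"

fun fv :: "('r, 'c) fm \<Rightarrow> nat set" where
  "fv Bot = {}"
| "fv (Eq s t) = fv_tm s \<union> fv_tm t"
| "fv (Atom R ts) = (\<Union>t\<in>set ts. fv_tm t)"
| "fv (Neg \<phi>) = fv \<phi>"
| "fv (Conj \<phi> \<psi>) = fv \<phi> \<union> fv \<psi>"
| "fv (Disj \<phi> \<psi>) = fv \<phi> \<union> fv \<psi>"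
| "fv (Ex v \<phi>) = fv \<phi> - {v}"
| "fv (All v \<phi>) = fv \<phi> - {v}"

fun wf_tm :: "('r, 'c) schema \<Rightarrow> 'c tm \<Rightarrow> bool" where
  "wf_tm \<tau> (Var v) \<longleftrightarrow> True"
| "wf_tm \<tau> (Const c) \<longleftrightarrow> c \<in> csyms \<tau>"

fun wf_fm :: "('r, 'c) schema \<Rightarrow> ('r, 'c) fm \<Rightarrow> bool" where
  "wf_fm \<tau> Bot \<longleftrightarrow> True"
| "wf_fm \<tau> (Eq s t) \<longleftrightarrow> wf_tm \<tau> s \<and> wf_tm \<tau> t"
| "wf_fm \<tau> (Atom R ts) \<longleftrightarrow> R \<in> rsyms \<tau> \<and> length ts = arity \<tau> R \<and> (\<forall>t\<in>set ts. wf_tm \<tau> t)"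
| "wf_fm \<tau> (Neg \<phi>) \<longleftrightarrow> wf_fm \<tau> \<phi>"
| "wf_fm \<tau> (Conj \<phi> \<psi>) \<longleftrightarrow> wf_fm \<tau> \<phi> \<and> wf_fm \<tau> \<psi>"
| "wf_fm \<tau> (Disj \<phi> \<psi>) \<longleftrightarrow> wf_fm \<tau> \<phi> \<and> wf_fm \<tau> \<psi>"
| "wf_fm \<tau> (Ex v \<phi>) \<longleftrightarrow> wf_fm \<tau> \<phi>"
| "wf_fm \<tau> (All v \<phi>) \<longleftrightarrow> wf_fm \<tau> \<phi>"

fun quantifier_free :: "('r, 'c) fm \<Rightarrow> bool" where
  "quantifier_free (Neg \<phi>) \<longleftrightarrow> quantifier_free \<phi>"
| "quantifier_free (Conj \<phi> \<psi>) \<longleftrightarrow> quantifier_free \<phi> \<and> quantifier_free \<psi>"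
| "quantifier_free (Disj \<phi> \<psi>) \<longleftrightarrow> quantifier_free \<phi> \<and> quantifier_free \<psi>"
| "quantifier_free (Ex v \<phi>) \<longleftrightarrow> False"
| "quantifier_free (All v \<phi>) \<longleftrightarrow> False"
| "quantifier_free _ \<longleftrightarrow> True"

definition sentence :: "('r, 'c) schema \<Rightarrow> ('r, 'c) fm \<Rightarrow> bool" where
  "sentence \<tau> \<phi> \<longleftrightarrow> wf_fm \<tau> \<phi> \<and> fv \<phi> = {}"

definition ex_all_form :: "('r, 'c) fm \<Rightarrow> bool" where
  "ex_all_form \<phi> \<longleftrightarrow> (\<exists>xs ys \<psi>. distinct (xs @ ys) \<and> quantifier_free \<psi> \<and>
     \<phi> = foldr Ex xs (foldr All ys \<psi>))"

text \<open>The truth value of a sentence does not depend on the assignment.\<close>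

definition defines_query ::
  "('r, 'c) schema \<Rightarrow> ('r, 'c) fm \<Rightarrow> (('d, 'r, 'c) db \<Rightarrow> bool) \<Rightarrow> bool" where
  "defines_query \<tau> \<phi> q \<longleftrightarrow> (\<forall>I\<in>databases \<tau>. \<forall>\<sigma>. range \<sigma> \<subseteq> domain I \<longrightarrow> (q I \<longleftrightarrow> sat I \<sigma> \<phi>))"


section \<open>Dynamic programs\<close>

datatype 'r op = Ins 'r | Del 'r

fun op_rel :: "'r op \<Rightarrow> 'r" where
  "op_rel (Ins S) = S"
| "op_rel (Del S) = S"

type_synonym ('d, 'r) modification = "'r op \<times> 'd list"

definition modifications :: "('r, 'c) schema \<Rightarrow> 'd set \<Rightarrow> ('d, 'r) modification set" where
  "modifications \<tau> D = {(\<delta>, as). op_rel \<delta> \<in> rsyms \<tau> \<and> as \<in> tuples D (arity \<tau> (op_rel \<delta>))}"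

fun modify :: "('d, 'r) modification \<Rightarrow> ('d, 'r, 'c) db \<Rightarrow> ('d, 'r, 'c) db" where
  "modify (Ins S, as) I = I\<lparr>rel := (rel I)(S := insert as (rel I S))\<rparr>"
| "modify (Del S, as) I = I\<lparr>rel := (rel I)(S := rel I S - {as})\<rparr>"

text \<open>Input symbols and auxiliary symbols are kept apart by a sum type.\<close>

definition dynamic_schema :: "('r, 'c) schema \<Rightarrow> ('s, 'c) schema \<Rightarrow> bool" where
  "dynamic_schema \<tau>in \<tau>aux \<longleftrightarrow> finite_schema \<tau>in \<and> finite_schema \<tau>aux \<and> csyms \<tau>aux = {}"

definition schema_union :: "('r, 'c) schema \<Rightarrow> ('s, 'c) schema \<Rightarrow> ('r + 's, 'c) schema" where
  "schema_union \<tau>in \<tau>aux =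
     \<lparr>rsyms = rsyms \<tau>in <+> rsyms \<tau>aux, arity = case_sum (arity \<tau>in) (arity \<tau>aux),
      csyms = csyms \<tau>in \<union> csyms \<tau>aux\<rparr>"

type_synonym ('d, 'r, 's, 'c) state = "('d, 'r, 'c) db \<times> ('s \<Rightarrow> 'd list set)"

definition state_db :: "('d, 'r, 's, 'c) state \<Rightarrow> ('d, 'r + 's, 'c) db" where
  "state_db = (\<lambda>(I, A). \<lparr>domain = domain I, rel = case_sum (rel I) A, const = const I\<rparr>)"

text \<open>In an update formula \<open>\<phi>(x; y)\<close> for an operation on an \<open>m\<close>-ary relation and an \<open>n\<close>-ary
  auxiliary relation, the tuple \<open>x\<close> consists of the variables \<open>0, \<dots>, m - 1\<close> and the tuple \<open>y\<close>
  of the variables \<open>m, \<dots>, m + n - 1\<close>.\<close>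

type_synonym ('r, 's, 'c) update_program = "'s \<Rightarrow> 'r op \<Rightarrow> ('r + 's, 'c) fm"

definition update_program ::
  "('r, 'c) schema \<Rightarrow> ('s, 'c) schema \<Rightarrow> ('r, 's, 'c) update_program \<Rightarrow> bool" where
  "update_program \<tau>in \<tau>aux P \<longleftrightarrow>
     (\<forall>R\<in>rsyms \<tau>aux. \<forall>\<delta>. op_rel \<delta> \<in> rsyms \<tau>in \<longrightarrow>
        wf_fm (schema_union \<tau>in \<tau>aux) (P R \<delta>) \<and>
        fv (P R \<delta>) \<subseteq> {..<arity \<tau>in (op_rel \<delta>) + arity \<tau>aux R})"

definition apply_mod ::
  "('s, 'c) schema \<Rightarrow> ('r, 's, 'c) update_program \<Rightarrow> ('d, 'r) modification \<Rightarrow>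
     ('d, 'r, 's, 'c) state \<Rightarrow> ('d, 'r, 's, 'c) state" where
  "apply_mod \<tau>aux P = (\<lambda>(\<delta>, as) (I, A).
     (modify (\<delta>, as) I,
      \<lambda>R\<in>rsyms \<tau>aux. {bs \<in> tuples (domain I) (arity \<tau>aux R).
         sat (state_db (I, A)) (\<lambda>v. (as @ bs) ! v) (P R \<delta>)}))"

record ('d, 'r, 's, 'c) dyn_program =
  upd   :: "('r, 's, 'c) update_program"
  init  :: "('d, 'r, 'c) db \<Rightarrow> ('s \<Rightarrow> 'd list set)"
  query :: 's

definition dynamic_program ::
  "('r, 'c) schema \<Rightarrow> ('s, 'c) schema \<Rightarrow> ('d, 'r, 's, 'c) dyn_program \<Rightarrow> bool" where
  "dynamic_program \<tau>in \<tau>aux \<P> \<longleftrightarrow>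
     dynamic_schema \<tau>in \<tau>aux \<and> update_program \<tau>in \<tau>aux (upd \<P>) \<and>
     (\<forall>I\<in>databases \<tau>in. init \<P> I \<in> rel_interps \<tau>aux (domain I)) \<and>
     query \<P> \<in> rsyms \<tau>aux"

definition DynProp_program ::
  "('r, 'c) schema \<Rightarrow> ('s, 'c) schema \<Rightarrow> ('d, 'r, 's, 'c) dyn_program \<Rightarrow> bool" where
  "DynProp_program \<tau>in \<tau>aux \<P> \<longleftrightarrow> dynamic_program \<tau>in \<tau>aux \<P> \<and>
     (\<forall>R\<in>rsyms \<tau>aux. \<forall>\<delta>. op_rel \<delta> \<in> rsyms \<tau>in \<longrightarrow> quantifier_free (upd \<P> R \<delta>))"

text \<open>A Boolean query is a query of arity zero: its result is \<open>{[]}\<close> (true) or \<open>{}\<close> (false).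
  Sequences of modifications are applied from left to right.\<close>

definition maintains ::
  "('r, 'c) schema \<Rightarrow> ('s, 'c) schema \<Rightarrow> ('d, 'r, 's, 'c) dyn_program \<Rightarrow>
     (('d, 'r, 'c) db \<Rightarrow> bool) \<Rightarrow> bool" where
  "maintains \<tau>in \<tau>aux \<P> q \<longleftrightarrow>
     arity \<tau>aux (query \<P>) = 0 \<and>
     (\<forall>I\<in>databases \<tau>in. \<forall>\<alpha>\<in>lists (modifications \<tau>in (domain I)).
        snd (fold (apply_mod \<tau>aux (upd \<P>)) \<alpha> (I, init \<P> I)) (query \<P>) =
          (if q (fold modify \<alpha> I) then {[]} else {}))"

end

(* The query says that the complement of the unary relation U is the set of successors of some
   node x under the binary relation E. Take an m-element set C and, for each family F of subsets
   of C, a database in which U is empty and the members X of F are represented by nodes outside C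
   whose non-successors are exactly the elements of X. Inserting X into U makes the query true
   iff X belongs to F. These modifications only involve tuples over C, and a quantifier-free
   program updates the auxiliary relations on C without looking outside C; so the restriction to C
   of the initial auxiliary database determines F. But there are 2^(2^m) families and, for fixed
   auxiliary arities, only 2^poly(m) restrictions. *)

theory Submission
  imports Defs "HOL-Library.Nat_Bijection" "HOL-Real_Asymp.Real_Asymp"
begin

section \<open>Quantifier-free programs on subdomains\<close>

text \<open>Equality of the substructures induced on \<open>C\<close>. The constants are required to
  lie in \<open>C\<close> so that terms over \<open>C\<close> stay in \<open>C\<close>; tuples
  leaving \<open>C\<close> are unconstrained.\<close>

definition agree_on :: "('r, 'c) schema \<Rightarrow> 'd set \<Rightarrow> ('d, 'r, 'c) db \<Rightarrow> ('d, 'r, 'c) db \<Rightarrow> bool" where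
  "agree_on \<tau> C I J \<longleftrightarrow> C \<subseteq> domain I \<inter> domain J \<and>
     (\<forall>c\<in>csyms \<tau>. const I c = const J c \<and> const J c \<in> C) \<and>
     (\<forall>R\<in>rsyms \<tau>. \<forall>as\<in>tuples C (arity \<tau> R). as \<in> rel I R \<longleftrightarrow> as \<in> rel J R)"

lemma eval_tm_agree_on:
  assumes "agree_on \<tau> C I J" "wf_tm \<tau> t" "\<sigma> ` fv_tm t \<subseteq> C"
  shows "eval_tm I \<sigma> t = eval_tm J \<sigma> t" "eval_tm I \<sigma> t \<in> C"
  using assms by (cases t; auto simp: agree_on_def)+

text \<open>Without quantifiers only atoms and equations are consulted, and their terms take values
  in \<open>C\<close>, where both databases coincide.\<close>

lemma sat_agree_on:
  assumes "agree_on \<tau> C I J" "quantifier_free \<phi>" "wf_fm \<tau> \<phi>" "\<sigma> ` fv \<phi> \<subseteq> C"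
  shows "sat I \<sigma> \<phi> \<longleftrightarrow> sat J \<sigma> \<phi>"
  using assms(2-)
proof (induction \<phi>)
  case (Eq s t)
  then show ?case
    using eval_tm_agree_on(1)[OF assms(1), of s] eval_tm_agree_on(1)[OF assms(1), of t]
    by (simp add: image_Un)
next
  case (Atom R ts)
  have t: "eval_tm I \<sigma> t = eval_tm J \<sigma> t \<and> eval_tm J \<sigma> t \<in> C" if "t \<in> set ts" for t
    using Atom.prems that eval_tm_agree_on[OF assms(1), of t \<sigma>] by fastforce
  then have eq: "map (eval_tm I \<sigma>) ts = map (eval_tm J \<sigma>) ts"
    by auto
  have "map (eval_tm I \<sigma>) ts \<in> tuples C (arity \<tau> R)" "R \<in> rsyms \<tau>"
    using Atom.prems t by (auto simp: tuples_def)
  then have "map (eval_tm I \<sigma>) ts \<in> rel I R \<longleftrightarrow> map (eval_tm I \<sigma>) ts \<in> rel J R"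
    using assms(1) by (simp add: agree_on_def)
  then show ?case
    by (simp only: sat.simps eq)
qed (auto simp: image_Un)

lemma agree_on_state_db:
  "agree_on (schema_union \<tau>in \<tau>aux) C (state_db (I, A)) (state_db (J, B)) \<longleftrightarrow>
     C \<subseteq> domain I \<inter> domain J \<and>
     (\<forall>c\<in>csyms \<tau>in \<union> csyms \<tau>aux. const I c = const J c \<and> const J c \<in> C) \<and>
     (\<forall>R\<in>rsyms \<tau>in. \<forall>as\<in>tuples C (arity \<tau>in R). as \<in> rel I R \<longleftrightarrow> as \<in> rel J R) \<and>
     (\<forall>R\<in>rsyms \<tau>aux. \<forall>as\<in>tuples C (arity \<tau>aux R). as \<in> A R \<longleftrightarrow> as \<in> B R)"
  by (simp add: agree_on_def schema_union_def state_db_def Plus_def ball_Un)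

lemma domain_modify [simp]: "domain (modify m I) = domain I"
  and const_modify [simp]: "const (modify m I) = const I"
  by (cases "(m, I)" rule: modify.cases; simp)+

lemma mem_rel_modify_cong:
  "as \<in> rel I R \<longleftrightarrow> as \<in> rel J R \<Longrightarrow> as \<in> rel (modify m I) R \<longleftrightarrow> as \<in> rel (modify m J) R"
  by (cases "(m, I)" rule: modify.cases; auto)

text \<open>Whether a tuple over \<open>C\<close> enters an auxiliary relation is decided by a
  quantifier-free formula whose parameters all lie in \<open>C\<close>.\<close>

lemma apply_mod_agree_on:
  assumes agree: "agree_on (schema_union \<tau>in \<tau>aux) C (state_db s) (state_db t)"
    and P: "update_program \<tau>in \<tau>aux P"
      "\<And>R \<delta>. R \<in> rsyms \<tau>aux \<Longrightarrow> op_rel \<delta> \<in> rsyms \<tau>in \<Longrightarrow> quantifier_free (P R \<delta>)"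
    and m: "m \<in> modifications \<tau>in C"
  shows "agree_on (schema_union \<tau>in \<tau>aux) C
    (state_db (apply_mod \<tau>aux P m s)) (state_db (apply_mod \<tau>aux P m t))"
proof -
  obtain I A J B \<delta> as where [simp]: "s = (I, A)" "t = (J, B)" "m = (\<delta>, as)"
    by (metis surj_pair)
  have \<delta>: "op_rel \<delta> \<in> rsyms \<tau>in" "as \<in> tuples C (arity \<tau>in (op_rel \<delta>))"
    using m by (auto simp: modifications_def)
  have C: "C \<subseteq> domain I" "C \<subseteq> domain J"
    using agree by (auto simp: agree_on_def state_db_def)
  have "sat (state_db (I, A)) (\<lambda>v. (as @ bs) ! v) (P R \<delta>) \<longleftrightarrow>
        sat (state_db (J, B)) (\<lambda>v. (as @ bs) ! v) (P R \<delta>)"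
    if "R \<in> rsyms \<tau>aux" "bs \<in> tuples C (arity \<tau>aux R)" for R bs
  proof (rule sat_agree_on)
    show "agree_on (schema_union \<tau>in \<tau>aux) C (state_db (I, A)) (state_db (J, B))"
      using agree by simp
    show "(!) (as @ bs) ` fv (P R \<delta>) \<subseteq> C"
    proof -
      \<comment> \<open>Indexing beyond the end of a list is unspecified, so this bound is what
        keeps the assignment inside \<open>C\<close>.\<close>
      have "fv (P R \<delta>) \<subseteq> {..<length (as @ bs)}"
        using P(1) that \<delta> by (auto simp: update_program_def tuples_def)
      moreover have "set (as @ bs) \<subseteq> C"
        using that \<delta> by (auto simp: tuples_def)
      ultimately show ?thesis
        using nth_mem[of _ "as @ bs"] by fast
    qed
  qed (use P that \<delta> in \<open>auto simp: update_program_def\<close>)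
  \<comment> \<open>The two domains may differ, but the domain filter in \<open>apply_mod\<close>
    discards no tuple over \<open>C\<close> in either state.\<close>
  moreover have "bs \<in> tuples (domain I) k \<and> bs \<in> tuples (domain J) k"
    if "bs \<in> tuples C k" for bs k
    using C that by (auto simp: tuples_def)
  ultimately show ?thesis
    using agree by (auto simp: agree_on_state_db apply_mod_def mem_rel_modify_cong[of _ I _ J])
qed

lemma fold_apply_mod_agree_on:
  assumes "update_program \<tau>in \<tau>aux P"
    and "\<And>R \<delta>. R \<in> rsyms \<tau>aux \<Longrightarrow> op_rel \<delta> \<in> rsyms \<tau>in \<Longrightarrow> quantifier_free (P R \<delta>)"
    and "agree_on (schema_union \<tau>in \<tau>aux) C (state_db s) (state_db t)"
    and "\<alpha> \<in> lists (modifications \<tau>in C)"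
  shows "agree_on (schema_union \<tau>in \<tau>aux) C
    (state_db (fold (apply_mod \<tau>aux P) \<alpha> s)) (state_db (fold (apply_mod \<tau>aux P) \<alpha> t))"
  using assms(4,3)
proof (induction \<alpha> arbitrary: s t rule: lists.induct)
  case (Cons m \<alpha>)
  then show ?case
    using apply_mod_agree_on[OF Cons.prems assms(1,2)] by simp
qed simp

text \<open>The initialization may inspect the whole database, so its agreement on \<open>C\<close>
  has to be assumed; after that nothing outside \<open>C\<close> can influence the answer.\<close>

lemma maintains_agree_on:
  assumes P: "DynProp_program \<tau>in \<tau>aux \<P>" "maintains \<tau>in \<tau>aux \<P> q"
    and IJ: "I \<in> databases \<tau>in" "J \<in> databases \<tau>in"
    and agree: "agree_on \<tau>in C I J"
    and init: "\<And>R. R \<in> rsyms \<tau>aux \<Longrightarrow>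
      init \<P> I R \<inter> tuples C (arity \<tau>aux R) = init \<P> J R \<inter> tuples C (arity \<tau>aux R)"
    and \<alpha>: "\<alpha> \<in> lists (modifications \<tau>in C)"
  shows "q (fold modify \<alpha> I) \<longleftrightarrow> q (fold modify \<alpha> J)"
proof -
  note defs = DynProp_program_def dynamic_program_def dynamic_schema_def maintains_def
  let ?run = "\<lambda>I. fold (apply_mod \<tau>aux (upd \<P>)) \<alpha> (I, init \<P> I)"
  have C: "C \<subseteq> domain I" "C \<subseteq> domain J"
    using agree by (auto simp: agree_on_def)
  have "agree_on (schema_union \<tau>in \<tau>aux) C (state_db (I, init \<P> I)) (state_db (J, init \<P> J))"
    using P(1) agree init unfolding agree_on_state_db by (fastforce simp: agree_on_def defs)
  then have "agree_on (schema_union \<tau>in \<tau>aux) C (state_db (?run I)) (state_db (?run J))"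
    by (intro fold_apply_mod_agree_on \<alpha>) (use P(1) in \<open>auto simp: defs\<close>)
  moreover have "query \<P> \<in> rsyms \<tau>aux" "arity \<tau>aux (query \<P>) = 0"
    using P by (auto simp: defs)
  \<comment> \<open>The empty tuple is a tuple over every \<open>C\<close>, so agreement covers a
    query symbol of arity 0.\<close>
  ultimately have "[] \<in> snd (?run I) (query \<P>) \<longleftrightarrow> [] \<in> snd (?run J) (query \<P>)"
    by (cases "?run I"; cases "?run J"; force simp: agree_on_state_db tuples_def)
  moreover have "modifications \<tau>in C \<subseteq> modifications \<tau>in (domain I)"
    "modifications \<tau>in C \<subseteq> modifications \<tau>in (domain J)"
    using C by (auto simp: modifications_def tuples_def)
  then have "\<alpha> \<in> lists (modifications \<tau>in (domain I))" "\<alpha> \<in> lists (modifications \<tau>in (domain J))"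
    using \<alpha> lists_mono by blast+
  ultimately show ?thesis
    using P(2) IJ by (auto simp: maintains_def split: if_splits)
qed


section \<open>Counting auxiliary databases\<close>

lemma finite_tuples: "finite C \<Longrightarrow> finite (tuples C k)"
  by (simp add: tuples_def finite_lists_length_eq)

lemma finite_rel_interps:
  assumes "finite_schema \<tau>" "finite C"
  shows "finite (rel_interps \<tau> C)"
  using assms by (auto simp: finite_schema_def rel_interps_def intro!: finite_PiE finite_tuples)

lemma card_rel_interps:
  assumes "finite_schema \<tau>" "finite C"
  shows "card (rel_interps \<tau> C) = 2 ^ (\<Sum>R\<in>rsyms \<tau>. card C ^ arity \<tau> R)"
proof -
  have "card (tuples C k) = card C ^ k" for k
    using assms by (simp add: tuples_def card_lists_length_eq)
  then show ?thesis
    using assms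
    by (simp add: finite_schema_def rel_interps_def card_PiE card_Pow finite_tuples power_sum)
qed

text \<open>Supplies the size of the set on which restrictions are counted. Each quotient
  \<open>m ^ k / 2 ^ m\<close> tends to 0, hence so does a finite sum of them.\<close>

lemma ex_sum_power_less_two_power:
  assumes "finite S"
  shows "\<exists>m. (\<Sum>R\<in>S. m ^ a R) < (2::nat) ^ m"
proof -
  have "(\<lambda>m. real m ^ k / 2 ^ m) \<longlonglongrightarrow> 0" for k
    by real_asymp
  then have "(\<lambda>m. \<Sum>R\<in>S. real m ^ a R / 2 ^ m) \<longlonglongrightarrow> (\<Sum>R\<in>S. 0)"
    by (intro tendsto_sum)
  then have "\<forall>\<^sub>F m in sequentially. (\<Sum>R\<in>S. real m ^ a R / 2 ^ m) < 1"
    by (intro order_tendstoD) auto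
  then obtain m where "(\<Sum>R\<in>S. real m ^ a R / 2 ^ m) < 1"
    using eventually_happens by force
  then have "real (\<Sum>R\<in>S. m ^ a R) < real (2 ^ m)"
    by (simp flip: sum_divide_distrib)
  then show ?thesis
    by (metis of_nat_less_iff)
qed


section \<open>The query and the databases encoding families of sets\<close>

text \<open>The relation symbol \<open>0\<close> is the unary \<open>U\<close> and the relation symbol \<open>1\<close> is the binary \<open>E\<close>.\<close>

definition nbhd_schema :: "(nat, nat) schema" where
  "nbhd_schema = \<lparr>rsyms = {0, 1}, arity = Suc, csyms = {}\<rparr>"

definition conbhd_query :: "(nat, nat, nat) db \<Rightarrow> bool" where
  "conbhd_query I \<longleftrightarrow> (\<exists>x\<in>domain I. \<forall>y\<in>domain I. [y] \<in> rel I 0 \<longleftrightarrow> [x, y] \<notin> rel I 1)"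

text \<open>The matrix is an exclusive or, which expresses the biconditional of
  \<open>conbhd_query\<close> with its negated side.\<close>

definition conbhd_fm :: "(nat, nat) fm" where
  "conbhd_fm = Ex 0 (All 1
     (Conj (Disj (Atom 0 [Var 1]) (Atom 1 [Var 0, Var 1]))
       (Neg (Conj (Atom 0 [Var 1]) (Atom 1 [Var 0, Var 1])))))"

lemma sentence_conbhd_fm: "sentence nbhd_schema conbhd_fm"
  by (auto simp: sentence_def conbhd_fm_def nbhd_schema_def)

lemma ex_all_form_conbhd_fm: "ex_all_form conbhd_fm"
  unfolding ex_all_form_def conbhd_fm_def
  by (rule exI[of _ "[0]"], rule exI[of _ "[1]"]) simp

lemma defines_query_conbhd_fm: "defines_query nbhd_schema conbhd_fm conbhd_query"
  unfolding defines_query_def conbhd_fm_def conbhd_query_def by auto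

text \<open>\<open>set_encode\<close> is injective on finite sets, and the shift by \<open>m\<close>
  moves the codes out of \<open>{..<m}\<close>.\<close>

definition set_node :: "nat \<Rightarrow> nat set \<Rightarrow> nat" where
  "set_node m X = m + set_encode X"

definition family_domain :: "nat \<Rightarrow> nat set" where
  "family_domain m = {..<m} \<union> set_node m ` Pow {..<m}"

text \<open>Every subset of \<open>{..<m}\<close> gets a node, so the domain is independent of
  \<open>F\<close>. Edges also lead to the nodes of sets, so that the non-successors of the node of
  a member \<open>X\<close> in the whole domain are just the elements of \<open>X\<close>.\<close>

definition family_db :: "nat \<Rightarrow> nat set set \<Rightarrow> (nat, nat, nat) db" where
  "family_db m F = \<lparr>domain = family_domain m,
     rel = (\<lambda>R\<in>{0, 1}. if R = 0 then {}
       else {[set_node m X, y] | X y. X \<in> F \<and> y \<in> family_domain m - X}),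
     const = (\<lambda>_. undefined)\<rparr>"

lemma set_node_inject:
  assumes "X \<subseteq> {..<m}" "Y \<subseteq> {..<m}"
  shows "set_node m X = set_node m Y \<longleftrightarrow> X = Y"
  using assms by (metis add_left_cancel finite_lessThan finite_subset set_encode_eq set_node_def)

lemma family_db_in_databases:
  assumes "F \<subseteq> Pow {..<m}"
  shows "family_db m F \<in> databases nbhd_schema"
  using assms
  by (fastforce simp: databases_def family_db_def family_domain_def nbhd_schema_def rel_interps_def
      tuples_def)

text \<open>Every edge starts at a node that is at least \<open>m\<close>, so both relations are
  empty on \<open>{..<m}\<close>.\<close>

lemma agree_on_family_db: "agree_on nbhd_schema {..<m} (family_db m F) (family_db m G)"
  by (auto simp: agree_on_def family_db_def family_domain_def nbhd_schema_def tuples_def set_node_def)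

lemma fold_modify_Ins:
  "fold modify (map (\<lambda>as. (Ins S, as)) ass) I = I\<lparr>rel := (rel I)(S := set ass \<union> rel I S)\<rparr>"
  by (induction ass arbitrary: I) auto

lemma conbhd_query_family_db:
  assumes F: "F \<subseteq> Pow {..<m}" and X: "X \<subseteq> {..<m}"
  shows "conbhd_query (fold modify (map (\<lambda>as. (Ins 0, as)) (map (\<lambda>y. [y]) (sorted_list_of_set X)))
           (family_db m F)) \<longleftrightarrow> X \<in> F"
proof -
  let ?D = "family_domain m"
  have "finite X"
    using X finite_subset by blast
  \<comment> \<open>After the insertions \<open>U\<close> is \<open>X\<close>; the negated
    existential says that there is no edge from \<open>x\<close> to \<open>y\<close>.\<close>
  then have "?thesis \<longleftrightarrow>
    (\<exists>x\<in>?D. \<forall>y\<in>?D. y \<in> X \<longleftrightarrow> \<not> (\<exists>Y\<in>F. x = set_node m Y \<and> y \<notin> Y)) = (X \<in> F)"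
    unfolding fold_modify_Ins conbhd_query_def family_db_def by (auto simp: image_iff)
  moreover have "X \<in> F"
    if x: "x \<in> ?D" "\<forall>y\<in>?D. y \<in> X \<longleftrightarrow> \<not> (\<exists>Y\<in>F. x = set_node m Y \<and> y \<notin> Y)" for x
  proof -
    \<comment> \<open>This node is the number \<open>m\<close>, which is not in \<open>X\<close>. So
      \<open>x\<close> must have an edge to it, and only nodes of members of \<open>F\<close> have
      outgoing edges.\<close>
    have m: "set_node m {} \<in> ?D - X"
      using X by (auto simp: family_domain_def) (auto simp: set_node_def)
    then obtain Y where Y: "Y \<in> F" "x = set_node m Y"
      using x by blast
    then have "y \<in> X \<longleftrightarrow> y \<in> Y" if "y \<in> ?D" for y
      using x(2) that F set_node_inject by (smt (verit) Pow_iff subsetD)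
    moreover have "X \<subseteq> ?D" "Y \<subseteq> ?D"
      using X Y F by (auto simp: family_domain_def)
    ultimately have "X = Y"
      by blast
    then show ?thesis
      using Y by simp
  qed
  moreover have "\<exists>x\<in>?D. \<forall>y\<in>?D. y \<in> X \<longleftrightarrow> \<not> (\<exists>Y\<in>F. x = set_node m Y \<and> y \<notin> Y)" if "X \<in> F"
  proof
    show "set_node m X \<in> ?D"
      using X by (auto simp: family_domain_def)
    show "\<forall>y\<in>?D. y \<in> X \<longleftrightarrow> \<not> (\<exists>Y\<in>F. set_node m X = set_node m Y \<and> y \<notin> Y)"
      using X F that set_node_inject by blast
  qed
  ultimately show ?thesis
    by blast
qed

lemma conbhd_query_not_maintained:
  fixes \<tau>aux :: "('s, nat) schema"
  assumes P: "DynProp_program nbhd_schema \<tau>aux \<P>" "maintains nbhd_schema \<tau>aux \<P> conbhd_query"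
  shows False
proof -
  have fin: "finite_schema \<tau>aux"
    using P(1) by (simp add: DynProp_program_def dynamic_program_def dynamic_schema_def)
  then obtain m where m: "(\<Sum>R\<in>rsyms \<tau>aux. m ^ arity \<tau>aux R) < 2 ^ m"
    using ex_sum_power_less_two_power by (metis finite_schema_def)
  let ?C = "{..<m}"
  \<comment> \<open>The restricted lambda makes \<open>r F\<close> extensional, hence an element of
    the finite set \<open>rel_interps\<close>.\<close>
  define r where "r F = (\<lambda>R\<in>rsyms \<tau>aux. init \<P> (family_db m F) R \<inter> tuples ?C (arity \<tau>aux R))" for F
  have "r ` Pow (Pow ?C) \<subseteq> rel_interps \<tau>aux ?C"
    by (auto simp: r_def rel_interps_def)
  then have "card (r ` Pow (Pow ?C)) \<le> card (rel_interps \<tau>aux ?C)"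
    by (intro card_mono finite_rel_interps fin) auto
  also have "\<dots> < card (Pow (Pow ?C))"
    using m by (simp add: card_rel_interps fin card_Pow)
  finally have "\<not> inj_on r (Pow (Pow ?C))"
    by (rule pigeonhole)
  then obtain F G where FG: "F \<subseteq> Pow ?C" "G \<subseteq> Pow ?C" "F \<noteq> G" "r F = r G"
    unfolding inj_on_def by blast
  \<comment> \<open>Inserting \<open>X\<close> into \<open>U\<close> from both databases gives the
    same answer, and that answer is membership of \<open>X\<close> in the family.\<close>
  have "X \<in> F \<longleftrightarrow> X \<in> G" if X: "X \<subseteq> ?C" for X
  proof -
    let ?\<alpha> = "map (\<lambda>as. (Ins 0, as)) (map (\<lambda>y. [y]) (sorted_list_of_set X))"
    have "finite X"
      using X finite_subset by blast
    then have "?\<alpha> \<in> lists (modifications nbhd_schema ?C)"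
      using X by (fastforce simp: modifications_def nbhd_schema_def tuples_def)
    moreover have "init \<P> (family_db m F) R \<inter> tuples ?C (arity \<tau>aux R) =
        init \<P> (family_db m G) R \<inter> tuples ?C (arity \<tau>aux R)" if "R \<in> rsyms \<tau>aux" for R
      using fun_cong[OF FG(4), of R] that by (simp add: r_def)
    ultimately have "conbhd_query (fold modify ?\<alpha> (family_db m F)) \<longleftrightarrow>
        conbhd_query (fold modify ?\<alpha> (family_db m G))"
      by (rule maintains_agree_on[OF P family_db_in_databases[OF FG(1)]
            family_db_in_databases[OF FG(2)] agree_on_family_db, rotated])
    then show ?thesis
      by (simp only: conbhd_query_family_db FG X)
  qed
  then show False
    using FG by blast
qed

theorem theorem5p8:
  shows "\<exists>(\<tau>in :: (nat, nat) schema) (q :: (nat, nat, nat) db \<Rightarrow> bool).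
    finite_schema \<tau>in \<and>
    (\<exists>\<phi>. sentence \<tau>in \<phi> \<and> ex_all_form \<phi> \<and> defines_query \<tau>in \<phi> q) \<and>
    \<not> (\<exists>(\<tau>aux :: (nat, nat) schema) (\<P> :: (nat, nat, nat, nat) dyn_program).
        DynProp_program \<tau>in \<tau>aux \<P> \<and> maintains \<tau>in \<tau>aux \<P> q)"
proof (intro exI conjI)
  show "finite_schema nbhd_schema"
    by (simp add: finite_schema_def nbhd_schema_def)
qed (use sentence_conbhd_fm ex_all_form_conbhd_fm defines_query_conbhd_fm
    conbhd_query_not_maintained in blast)+

end
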